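(* Let $1\le L\le r$. Suppose the step sizes satisfy $0<\eta_k\le c_0$ with $c_0\max_i\|a_i\|^2\le1$. Then for every $k\ge1$, with $e_k^\delta=x_k^\delta-x^\dag$, $$\|\mathbb{E}[P_{\mathcal{L}}e_{k+1}^\delta]\|\le(1-\eta_k\sigma_L^2)\,\|\mathbb{E}[P_{\mathcal{L}}e_k^\delta]\|+c_0^{-\frac12}\eta_k\bar\delta,$$ $$\|\mathbb{E}[P_{\mathcal{H}}e_{k+1}^\delta]\|\le\|\mathbb{E}[P_{\mathcal{H}}e_k^\delta]\|+\eta_k\sigma_{L+1}\bar\delta.$$
   Context: Let $A\in\mathbb{R}^{n\times m}$ have rank $r\ge1$, with $i$th row written as a column vector $a_i\in\mathbb{R}^m$, let $x_1\in\mathbb{R}^m$ be a fixed (deterministic) initial guess, and let $y^\dag\in\mathbb{R}^n$ be exact data in the range of $A$. The reference solution is $x^\dag=\arg\min\{\|x-x_1\|: x\in\mathbb{R}^m,\ Ax=y^\dag\}$. Noisy data are $y^\delta=y^\dag+\xi$ with noise level $\delta=\|\xi\|$, and $\bar\delta=n^{-1/2}\delta$; $\xi$ (a realization of an i.i.d. mean-zero Gaussian vector) is fixed, and all expectations are only over the random indices below. Stochastic gradient descent (SGD): $x_1^\delta=x_1$ and $$x_{k+1}^\delta=x_k^\delta-\eta_k\big((a_{i_k},x_k^\delta)-y^\delta_{i_k}\big)a_{i_k},\quad k=1,2,\ldots,$$ where the indices $i_k$ are drawn i.i.d. uniformly from $\{1,\ldots,n\}$. Let $n^{-1/2}A=U\Sigma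 V^t$ be a singular value decomposition with $U\in\mathbb{R}^{n\times n}$, $V=[v_1\ \cdots\ v_m]\in\mathbb{R}^{m\times m}$ orthonormal and $\Sigma=\mathrm{diag}(\sigma_1,\ldots,\sigma_r,0,\ldots,0)\in\mathbb{R}^{n\times m}$, $\sigma_1\ge\cdots\ge\sigma_r>0$ (and $\sigma_i=0$ for $i>r$). Set $\mathcal{L}=\mathrm{span}\{v_i\}_{i=1}^L$ and $\mathcal{H}=\mathrm{span}\{v_i\}_{i=L+1}^{\min(n,m)}$, with orthogonal projections $P_{\mathcal{L}}$ and $P_{\mathcal{H}}$. $\|\cdot\|$ is the Euclidean norm. *)

theory Defs
  imports "HOL-Probability.Probability"
begin

text \<open>
  The finite index types carry no order, so the numbering \<open>1, 2, \<dots>\<close> of the diagonal of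
  \<open>\<Sigma>\<close> and of the columns of \<open>U\<close> and \<open>V\<close> is given by enumerations
  \<open>\<rho>\<close> and \<open>\<kappa>\<close> of these types.
\<close>

definition enumeration :: "('a::finite \<Rightarrow> nat) \<Rightarrow> bool" where
  "enumeration \<rho> \<longleftrightarrow> bij_betw \<rho> UNIV {1..CARD('a)}"

definition rect_diag :: "('n::finite \<Rightarrow> nat) \<Rightarrow> ('m::finite \<Rightarrow> nat) \<Rightarrow> (nat \<Rightarrow> real) \<Rightarrow> real^'m^'n" where
  "rect_diag \<rho> \<kappa> \<sigma> = (\<chi> i j. if \<rho> i = \<kappa> j then \<sigma> (\<rho> i) else 0)"

text \<open>
  The sequence \<open>\<sigma>\<close> is 0 at every index beyond the rank, including indices that exceed
  the size of the matrix.
\<close>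

definition is_svd ::
  "('n::finite \<Rightarrow> nat) \<Rightarrow> ('m::finite \<Rightarrow> nat) \<Rightarrow> real^'m^'n \<Rightarrow> real^'n^'n \<Rightarrow> (nat \<Rightarrow> real) \<Rightarrow> real^'m^'m \<Rightarrow> bool"
  where
  "is_svd \<rho> \<kappa> B U \<sigma> V \<longleftrightarrow>
     orthogonal_matrix U \<and> orthogonal_matrix V \<and>
     B = U ** rect_diag \<rho> \<kappa> \<sigma> ** transpose V \<and>
     (\<forall>i j. 1 \<le> i \<and> i \<le> j \<and> j \<le> rank B \<longrightarrow> \<sigma> j \<le> \<sigma> i) \<and>
     (\<forall>i\<in>{1..rank B}. 0 < \<sigma> i) \<and>
     (\<forall>i>rank B. \<sigma> i = 0)"

definition col_span :: "('m::finite \<Rightarrow> nat) \<Rightarrow> real^'m^'m \<Rightarrow> nat set \<Rightarrow> (real^'m) set" where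
  "col_span \<kappa> V I = span {column j V | j. \<kappa> j \<in> I}"

definition orth_proj :: "'a::euclidean_space set \<Rightarrow> 'a \<Rightarrow> 'a" where
  "orth_proj S x = (THE p. p \<in> S \<and> (\<forall>w\<in>S. orthogonal (x - p) w))"

lemma orth_proj_unique:
  fixes S :: "'a::euclidean_space set"
  assumes "subspace S"
  shows "\<exists>!p. p \<in> S \<and> (\<forall>w\<in>S. orthogonal (x - p) w)"
proof -
  obtain p z where "p \<in> span S" "\<And>w. w \<in> span S \<Longrightarrow> orthogonal z w" "x = p + z"
    using orthogonal_subspace_decomp_exists [of S x] by metis
  then have p: "p \<in> S" "\<forall>w\<in>S. orthogonal (x - p) w"
    using assms by (auto simp: span_eq_iff [THEN iffD2])
  have "p' = p" if "p' \<in> S" "\<forall>w\<in>S. orthogonal (x - p') w" for p'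
  proof -
    have "p - p' \<in> S" using assms p(1) that(1) by (rule subspace_diff)
    then have "(x - p) \<bullet> (p - p') = 0" "(x - p') \<bullet> (p - p') = 0"
      using p(2) that(2) by (auto simp: orthogonal_def)
    then have "(p - p') \<bullet> (p - p') = 0" by (simp add: inner_diff_left)
    then show ?thesis by simp
  qed
  with p show ?thesis by blast
qed

text \<open>
  The path of the iteration for a realisation \<open>i\<close> of the indices.  Numbering starts at 1;
  the value at 0 is a dummy.
\<close>

fun sgd ::
  "real^'m^'n \<Rightarrow> real^'n \<Rightarrow> (nat \<Rightarrow> real) \<Rightarrow> real^'m \<Rightarrow> (nat \<Rightarrow> 'n) \<Rightarrow> nat \<Rightarrow> real^'m" where
  "sgd A y \<eta> x\<^sub>1 i 0 = x\<^sub>1"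
| "sgd A y \<eta> x\<^sub>1 i (Suc 0) = x\<^sub>1"
| "sgd A y \<eta> x\<^sub>1 i (Suc (Suc k)) =
     sgd A y \<eta> x\<^sub>1 i (Suc k)
       - (\<eta> (Suc k) * (row (i (Suc k)) A \<bullet> sgd A y \<eta> x\<^sub>1 i (Suc k) - y $ i (Suc k)))
           *\<^sub>R row (i (Suc k)) A"

end

theory Submission
  imports Defs
begin

text \<open>
  Write \<open>B = n\<^sup>-\<^sup>1\<^sup>/\<^sup>2 A\<close>.  The iterate at step \<open>k\<close> depends only on the indices drawn before \<open>k\<close>, so
  averaging over \<open>i\<^sub>k\<close> turns one step of SGD into a Landweber step for the mean error \<open>w\<^sub>k\<close>:
  \<open>w\<^sub>k\<^sub>+\<^sub>1 = w\<^sub>k - \<eta>\<^sub>k B\<^sup>t (B w\<^sub>k - n\<^sup>-\<^sup>1\<^sup>/\<^sup>2 \<xi>)\<close>.  In the basis of right singular vectors this is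
  diagonal: the \<open>j\<close>-th coordinate is multiplied by \<open>1 - \<eta>\<^sub>k \<sigma>\<^sub>j\<^sup>2\<close> and receives \<open>\<eta>\<^sub>k \<sigma>\<^sub>j\<close> times the
  \<open>j\<close>-th left coordinate of the scaled noise.  Minkowski's inequality over the coordinates of either
  subspace, together with \<open>c\<^sub>0 \<sigma>\<^sub>j\<^sup>2 \<le> c\<^sub>0 max\<^sub>i \<parallel>a\<^sub>i\<parallel>\<^sup>2 \<le> 1\<close>, gives both bounds.
\<close>

text \<open>This simp rule would turn \<open>transpose B *v z\<close> into \<open>z v* B\<close>,
  while the lemmas below are phrased with explicit transposes.\<close>

declare transpose_matrix_vector[simp del]

section \<open>Enumerations and orthogonal projections onto spans of columns\<close>

lemma enumeration_inj: "enumeration \<kappa> \<Longrightarrow> inj \<kappa>"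
  by (simp add: enumeration_def bij_betw_def)

lemma enumeration_ge_1: "enumeration \<kappa> \<Longrightarrow> 1 \<le> \<kappa> j"
  unfolding enumeration_def bij_betw_def by (metis atLeastAtMost_iff rangeI)

lemma orth_proj_eqI:
  fixes S :: "'a::euclidean_space set"
  assumes "subspace S" "p \<in> S" "\<And>w. w \<in> S \<Longrightarrow> orthogonal (x - p) w"
  shows "orth_proj S x = p"
  unfolding orth_proj_def
  by (rule the1_equality[OF orth_proj_unique[OF assms(1)]]) (use assms in auto)

lemma orthogonal_matrix_column_inner:
  fixes V :: "real^'m^'m"
  assumes "orthogonal_matrix V"
  shows "column i V \<bullet> column j V = (if i = j then 1 else 0)"
  using assms unfolding orthogonal_matrix_orthonormal_columns
  by (auto simp: orthogonal_def norm_eq_1)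

lemma column_inner_sum:
  fixes V :: "real^'m^'m"
  assumes "orthogonal_matrix V"
  shows "column i V \<bullet> (\<Sum>j\<in>J. c j *\<^sub>R column j V) = (if i \<in> J then c i else 0)"
  using assms by (simp add: inner_sum_right orthogonal_matrix_column_inner if_distrib cong: if_cong)

text \<open>The Fourier sum over an orthonormal family lies in the span, and its residual is
  orthogonal to each selected column, hence to the whole span.\<close>

lemma orth_proj_col_span:
  fixes V :: "real^'m^'m"
  assumes V: "orthogonal_matrix V"
  shows "orth_proj (col_span \<kappa> V I) x = (\<Sum>j | \<kappa> j \<in> I. (column j V \<bullet> x) *\<^sub>R column j V)"
    (is "_ = ?p")
proof (rule orth_proj_eqI)
  show "subspace (col_span \<kappa> V I)"
    by (simp add: col_span_def)
  show "?p \<in> col_span \<kappa> V I"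
    unfolding col_span_def by (intro span_sum span_scale span_base) auto
  fix w assume w: "w \<in> col_span \<kappa> V I"
  show "orthogonal (x - ?p) w"
  proof (rule orthogonal_to_span[OF w[unfolded col_span_def]])
    fix y assume "y \<in> {column j V | j. \<kappa> j \<in> I}"
    then obtain j where "y = column j V" "\<kappa> j \<in> I"
      by blast
    then show "orthogonal (x - ?p) y"
      by (simp add: orthogonal_def inner_commute[of _ "column j V"] inner_diff_right
          column_inner_sum[OF V])
  qed
qed

text \<open>Parseval's identity; it reduces estimates of projected vectors to estimates of their
  coordinates.\<close>

lemma norm_orth_proj_col_span:
  fixes V :: "real^'m^'m"
  assumes V: "orthogonal_matrix V"
  shows "norm (orth_proj (col_span \<kappa> V I) x) = L2_set (\<lambda>j. column j V \<bullet> x) {j. \<kappa> j \<in> I}"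
proof -
  have "p \<bullet> p = (\<Sum>j | \<kappa> j \<in> I. (column j V \<bullet> x)\<^sup>2)"
    if "p = (\<Sum>j | \<kappa> j \<in> I. (column j V \<bullet> x) *\<^sub>R column j V)" for p
    unfolding that by (subst inner_sum_left) (simp add: column_inner_sum[OF V] power2_eq_square)
  then show ?thesis
    by (simp add: orth_proj_col_span[OF V] norm_eq_sqrt_inner L2_set_def)
qed

text \<open>Needed to exchange the projection with the expectation.\<close>

lemma bounded_linear_orth_proj_col_span:
  fixes V :: "real^'m^'m"
  assumes V: "orthogonal_matrix V"
  shows "bounded_linear (orth_proj (col_span \<kappa> V I))"
proof -
  have "orth_proj (col_span \<kappa> V I) = (\<lambda>x. \<Sum>j | \<kappa> j \<in> I. (column j V \<bullet> x) *\<^sub>R column j V)"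
    by (auto simp: orth_proj_col_span[OF V])
  then show ?thesis
    by (auto intro!: bounded_linear_sum bounded_linear_scaleR_const bounded_linear_inner_right)
qed

section \<open>Singular value decomposition in coordinates\<close>

text \<open>Values up to the rank are positive and all later ones are 0, so the ordering extends
  past the rank.\<close>

lemma is_svd_antimono:
  assumes "is_svd \<rho> \<kappa> B U \<sigma> V" "1 \<le> i" "i \<le> j"
  shows "\<sigma> j \<le> \<sigma> i"
  using assms unfolding is_svd_def
  by (cases "j \<le> rank B"; cases "i \<le> rank B") (auto intro: less_imp_le)

lemma is_svd_nonneg:
  assumes "is_svd \<rho> \<kappa> B U \<sigma> V" "1 \<le> i"
  shows "0 \<le> \<sigma> i"
  using assms unfolding is_svd_def
  by (cases "i \<le> rank B") (auto intro: less_imp_le)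

text \<open>
  The coefficient of \<open>z\<close> along the left singular vector paired with the \<open>j\<close>-th right one;
  the sum has at most one term, and is 0 when the index of \<open>j\<close> exceeds the number of rows.
\<close>

definition left_coord ::
  "('n::finite \<Rightarrow> nat) \<Rightarrow> ('m::finite \<Rightarrow> nat) \<Rightarrow> real^'n^'n \<Rightarrow> real^'n \<Rightarrow> 'm \<Rightarrow> real" where
  "left_coord \<rho> \<kappa> U z j = (\<Sum>i | \<rho> i = \<kappa> j. column i U \<bullet> z)"

lemma transpose_vector_component: "(transpose V *v z) $ j = column j V \<bullet> z"
  for V :: "real^'m^'n"
  by (simp add: matrix_vector_mult_def transpose_def column_def inner_vec_def)

text \<open>In \<open>transpose V ** transpose B\<close> the factor \<open>transpose V ** V\<close>
  cancels, leaving the transposed diagonal applied to the left coordinates.\<close>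

lemma column_inner_svd_transpose:
  assumes "is_svd \<rho> \<kappa> B U \<sigma> V"
  shows "column j V \<bullet> (transpose B *v z) = \<sigma> (\<kappa> j) * left_coord \<rho> \<kappa> U z j"
proof -
  have V: "transpose V ** V = mat 1" and B: "B = U ** rect_diag \<rho> \<kappa> \<sigma> ** transpose V"
    using assms by (auto simp: is_svd_def orthogonal_matrix_def)
  have "column j V \<bullet> (transpose B *v z) = (transpose V *v (transpose B *v z)) $ j"
    by (simp add: transpose_vector_component)
  also have "transpose V *v (transpose B *v z)
      = (transpose V ** V) *v (transpose (rect_diag \<rho> \<kappa> \<sigma>) *v (transpose U *v z))"
    by (simp add: B matrix_transpose_mul transpose_transpose matrix_vector_mul_assoc matrix_mul_assoc)
  also have "\<dots> $ j = (\<Sum>i\<in>UNIV. if \<rho> i = \<kappa> j then \<sigma> (\<rho> i) * (column i U \<bullet> z) else 0)"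
    by (simp add: V transpose_vector_component)
      (simp add: column_def rect_diag_def inner_vec_def[of "vec_lambda _"]
        transpose_vector_component if_distrib[of "\<lambda>x. x * _"] cong: if_cong)
  also have "\<dots> = \<sigma> (\<kappa> j) * left_coord \<rho> \<kappa> U z j"
    by (auto simp: left_coord_def sum_distrib_left sum.If_cases intro!: sum.cong)
  finally show ?thesis .
qed

lemma rect_diag_mult_component:
  "(rect_diag \<rho> \<kappa> \<sigma> *v u) $ i = (\<Sum>j\<in>UNIV. if \<rho> i = \<kappa> j then \<sigma> (\<rho> i) * u $ j else 0)"
  by (simp add: matrix_vector_mult_def rect_diag_def if_distrib[of "\<lambda>x. x * _"] cong: if_cong)

lemma left_coord_svd:
  fixes B :: "real^'m^'n"
  assumes enum: "enumeration \<rho>" "enumeration \<kappa>" and svd: "is_svd \<rho> \<kappa> B U \<sigma> V"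
  shows "left_coord \<rho> \<kappa> U (B *v x) j = \<sigma> (\<kappa> j) * (column j V \<bullet> x)"
proof -
  have U: "transpose U ** U = mat 1" and B: "B = U ** rect_diag \<rho> \<kappa> \<sigma> ** transpose V"
    using svd by (auto simp: is_svd_def orthogonal_matrix_def)
  have inj: "inj \<rho>" "inj \<kappa>"
    using enum by (auto intro: enumeration_inj)
  have "transpose U *v (B *v x) = (transpose U ** U) *v (rect_diag \<rho> \<kappa> \<sigma> *v (transpose V *v x))"
    by (simp add: B matrix_vector_mul_assoc matrix_mul_assoc)
  then have *: "column i U \<bullet> (B *v x)
      = (\<Sum>j\<in>UNIV. if \<rho> i = \<kappa> j then \<sigma> (\<rho> i) * (column j V \<bullet> x) else 0)" for i
    unfolding transpose_vector_component[symmetric]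
    by (simp add: U rect_diag_mult_component)
  have **: "column i U \<bullet> (B *v x) = \<sigma> (\<kappa> j) * (column j V \<bullet> x)" if "\<rho> i = \<kappa> j" for i
    using inj(2) that by (simp add: * inj_eq)
  show ?thesis
  proof (cases "\<exists>i. \<rho> i = \<kappa> j")
    case True
    then obtain i where i: "\<rho> i = \<kappa> j" ..
    then have "{i. \<rho> i = \<kappa> j} = {i}"
      using inj(1) by (auto simp: inj_eq simp flip: i)
    with ** i show ?thesis
      by (simp add: left_coord_def)
  next
    case False
    \<comment> \<open>No left singular vector is paired with \<open>j\<close>, so
      \<open>\<kappa> j\<close> exceeds the number of rows and hence the rank; both sides are then
      0.\<close>
    have "1 \<le> \<kappa> j"
      by (rule enumeration_ge_1[OF enum(2)])
    moreover have "\<kappa> j \<notin> {1..CARD('n)}"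
      using False enum(1) unfolding enumeration_def bij_betw_def by (metis rangeE)
    moreover have "rank B \<le> CARD('n)"
      using rank_bound[of B] by simp
    ultimately have "\<sigma> (\<kappa> j) = 0"
      using svd by (auto simp: is_svd_def)
    with False show ?thesis
      by (simp add: left_coord_def)
  qed
qed

text \<open>The columns of \<open>V\<close> diagonalize \<open>transpose B ** B\<close>, with the
  squared singular values as eigenvalues.\<close>

lemma column_inner_svd_gram:
  assumes "enumeration \<rho>" "enumeration \<kappa>" "is_svd \<rho> \<kappa> B U \<sigma> V"
  shows "column j V \<bullet> (transpose B *v (B *v x)) = (\<sigma> (\<kappa> j))\<^sup>2 * (column j V \<bullet> x)"
  using column_inner_svd_transpose[OF assms(3)] left_coord_svd[OF assms]
  by (simp add: power2_eq_square)

text \<open>The Gram identity tested on the unit vector \<open>column j V\<close>; it opens the way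
  to bounding singular values by row norms.\<close>

lemma singular_value_eq_norm:
  assumes "enumeration \<rho>" "enumeration \<kappa>" "is_svd \<rho> \<kappa> B U \<sigma> V"
  shows "(norm (B *v column j V))\<^sup>2 = (\<sigma> (\<kappa> j))\<^sup>2"
proof -
  have "orthogonal_matrix V"
    using assms(3) by (simp add: is_svd_def)
  then show ?thesis
    using column_inner_svd_gram[OF assms, of j "column j V"]
    by (simp add: orthogonal_matrix_column_inner dot_lmul_matrix[symmetric]
        transpose_matrix_vector power2_norm_eq_inner inner_commute)
qed

text \<open>Bessel's inequality: distinct \<open>j\<close> are paired with distinct columns of the
  orthogonal matrix \<open>U\<close>.\<close>

lemma left_coord_L2_le:
  assumes enum: "enumeration \<rho>" "enumeration \<kappa>" and U: "orthogonal_matrix U"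
  shows "L2_set (left_coord \<rho> \<kappa> U z) J \<le> norm z"
proof -
  have inj: "inj \<rho>" "inj \<kappa>"
    using enum by (auto intro: enumeration_inj)
  \<comment> \<open>Writing the square of the one-term sum as a sum over all \<open>i\<close>
    prepares the exchange of summations.\<close>
  have le: "(left_coord \<rho> \<kappa> U z j)\<^sup>2 \<le> (\<Sum>i\<in>UNIV. if \<rho> i = \<kappa> j then (column i U \<bullet> z)\<^sup>2 else 0)" for j
  proof (cases "\<exists>i. \<rho> i = \<kappa> j")
    case True
    then obtain i where i: "\<rho> i = \<kappa> j" ..
    then have "{i. \<rho> i = \<kappa> j} = {i}"
      using inj(1) by (auto simp: inj_eq simp flip: i)
    then show ?thesis
      by (simp add: left_coord_def sum.If_cases)
  qed (simp add: left_coord_def)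
  have "(\<Sum>j\<in>J. (left_coord \<rho> \<kappa> U z j)\<^sup>2)
      \<le> (\<Sum>j\<in>UNIV. \<Sum>i\<in>UNIV. if \<rho> i = \<kappa> j then (column i U \<bullet> z)\<^sup>2 else 0)"
    by (rule order_trans[OF sum_mono[OF le] sum_mono2]) (auto intro!: sum_nonneg)
  also have "\<dots> = (\<Sum>i\<in>UNIV. \<Sum>j\<in>UNIV. if \<rho> i = \<kappa> j then (column i U \<bullet> z)\<^sup>2 else 0)"
    by (rule sum.swap)
  \<comment> \<open>After the exchange, injectivity of \<open>\<kappa>\<close> leaves at most one
    \<open>j\<close> for each \<open>i\<close>.\<close>
  also have "\<dots> \<le> (\<Sum>i\<in>UNIV. (column i U \<bullet> z)\<^sup>2)"
  proof (rule sum_mono)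
    fix i
    have "card {j. \<rho> i = \<kappa> j} \<le> 1"
      using inj(2) by (auto simp: card_le_Suc0_iff_eq inj_eq dest: injD)
    then have "real (card {j. \<rho> i = \<kappa> j}) \<le> 1"
      by simp
    then show "(\<Sum>j\<in>UNIV. if \<rho> i = \<kappa> j then (column i U \<bullet> z)\<^sup>2 else 0) \<le> (column i U \<bullet> z)\<^sup>2"
      by (simp add: sum.If_cases mult_left_le_one_le)
  qed
  also have "\<dots> = (norm (transpose U *v z))\<^sup>2"
    by (simp add: norm_vec_def L2_set_def sum_nonneg transpose_vector_component)
  also have "\<dots> = (norm z)\<^sup>2"
    using U orthogonal_transformation_norm[of "(*v) (transpose U)" z]
    by (simp add: orthogonal_transformation_matrix orthogonal_matrix_transpose)
  finally show ?thesis
    by (auto simp: L2_set_def intro: real_le_lsqrt)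
qed

section \<open>One Landweber step under a spectral projection\<close>

text \<open>\<open>C\<close> bounds the factors acting on the old error and \<open>D\<close> those
  acting on the noise. Keeping both free lets one estimate serve both subspaces.\<close>

lemma norm_orth_proj_landweber_le:
  fixes B :: "real^'m^'n"
  assumes enum: "enumeration \<rho>" "enumeration \<kappa>" and svd: "is_svd \<rho> \<kappa> B U \<sigma> V"
    and t: "0 \<le> t"
    and C: "0 \<le> C" "\<And>j. \<kappa> j \<in> I \<Longrightarrow> \<bar>1 - t * (\<sigma> (\<kappa> j))\<^sup>2\<bar> \<le> C"
    and D: "0 \<le> D" "\<And>j. \<kappa> j \<in> I \<Longrightarrow> \<sigma> (\<kappa> j) \<le> D"
  defines "P \<equiv> orth_proj (col_span \<kappa> V I)"
  shows "norm (P (w - t *\<^sub>R (transpose B *v (B *v w - z)))) \<le> C * norm (P w) + D * t * norm z"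
proof -
  have U: "orthogonal_matrix U" and V: "orthogonal_matrix V"
    using svd by (auto simp: is_svd_def)
  let ?J = "{j. \<kappa> j \<in> I}" and ?g = "left_coord \<rho> \<kappa> U z"
  have pos: "0 \<le> \<sigma> (\<kappa> j)" for j
    by (rule is_svd_nonneg[OF svd enumeration_ge_1[OF enum(2)]])
  have eq: "column j V \<bullet> (w - t *\<^sub>R (transpose B *v (B *v w - z)))
      = (1 - t * (\<sigma> (\<kappa> j))\<^sup>2) * (column j V \<bullet> w) + t * \<sigma> (\<kappa> j) * ?g j" for j
    by (simp add: inner_diff_right matrix_vector_mult_diff_distrib column_inner_svd_transpose[OF svd]
        left_coord_svd[OF enum svd] algebra_simps power2_eq_square)
  have "norm (P (w - t *\<^sub>R (transpose B *v (B *v w - z))))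
      \<le> L2_set (\<lambda>j. (1 - t * (\<sigma> (\<kappa> j))\<^sup>2) * (column j V \<bullet> w)) ?J
        + L2_set (\<lambda>j. t * \<sigma> (\<kappa> j) * ?g j) ?J"
    unfolding P_def norm_orth_proj_col_span[OF V] eq by (rule L2_set_triangle_ineq)
  \<comment> \<open>Monotonicity of \<open>L2_set\<close> needs nonnegative entries, hence the
    passage to absolute values here and for the noise term.\<close>
  also have "L2_set (\<lambda>j. (1 - t * (\<sigma> (\<kappa> j))\<^sup>2) * (column j V \<bullet> w)) ?J
      = L2_set (\<lambda>j. \<bar>1 - t * (\<sigma> (\<kappa> j))\<^sup>2\<bar> * \<bar>column j V \<bullet> w\<bar>) ?J"
    by (simp add: L2_set_def power_mult_distrib)
  also have "\<dots> \<le> L2_set (\<lambda>j. C * \<bar>column j V \<bullet> w\<bar>) ?J"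
    by (rule L2_set_mono) (auto intro!: mult_right_mono C)
  also have "\<dots> = C * norm (P w)"
    unfolding P_def norm_orth_proj_col_span[OF V]
    by (simp add: L2_set_right_distrib[symmetric] C(1)) (simp add: L2_set_def)
  also have "L2_set (\<lambda>j. t * \<sigma> (\<kappa> j) * ?g j) ?J = L2_set (\<lambda>j. t * \<sigma> (\<kappa> j) * \<bar>?g j\<bar>) ?J"
    by (simp add: L2_set_def power_mult_distrib)
  also have "\<dots> \<le> L2_set (\<lambda>j. t * D * \<bar>?g j\<bar>) ?J"
    by (rule L2_set_mono) (auto intro!: mult_right_mono mult_left_mono mult_nonneg_nonneg D pos t)
  also have "\<dots> = t * D * L2_set ?g ?J"
    using t D(1) by (simp add: L2_set_right_distrib[symmetric]) (simp add: L2_set_def)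
  also have "\<dots> \<le> t * D * norm z"
    by (intro mult_left_mono left_coord_L2_le[OF enum U] mult_nonneg_nonneg t D(1))
  finally show ?thesis
    by (simp add: mult_ac)
qed

section \<open>Operator bound from the row norms\<close>

text \<open>Cauchy-Schwarz in each row. The factor \<open>CARD('n)\<close> will cancel against the
  scaling of \<open>B\<close>.\<close>

lemma norm_matrix_vector_le_Max_row:
  fixes A :: "real^'m^'n"
  shows "(norm (A *v x))\<^sup>2 \<le> real CARD('n) * Max (range (\<lambda>i. (norm (row i A))\<^sup>2)) * (norm x)\<^sup>2"
proof -
  have "(norm (A *v x))\<^sup>2 = (\<Sum>i\<in>UNIV. (row i A \<bullet> x)\<^sup>2)"
    by (simp add: norm_vec_def L2_set_def sum_nonneg matrix_vector_mul_component row_def)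
  also have "\<dots> \<le> (\<Sum>i\<in>(UNIV::'n set). Max (range (\<lambda>i. (norm (row i A))\<^sup>2)) * (norm x)\<^sup>2)"
  proof (rule sum_mono)
    fix i
    have "(row i A \<bullet> x)\<^sup>2 \<le> (norm (row i A))\<^sup>2 * (norm x)\<^sup>2"
      using Cauchy_Schwarz_ineq[of "row i A" x] by (simp add: power2_norm_eq_inner)
    also have "\<dots> \<le> Max (range (\<lambda>i. (norm (row i A))\<^sup>2)) * (norm x)\<^sup>2"
      by (intro mult_right_mono) auto
    finally show "(row i A \<bullet> x)\<^sup>2 \<le> Max (range (\<lambda>i. (norm (row i A))\<^sup>2)) * (norm x)\<^sup>2" .
  qed
  finally show ?thesis
    by simp
qed

section \<open>Dependence of the SGD path on the drawn indices\<close>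

text \<open>Source of measurability, finite range and independence: the iterate numbered
  \<open>k\<close> has not yet seen draw \<open>k\<close>.\<close>

lemma sgd_cong:
  "(\<And>l. 1 \<le> l \<Longrightarrow> l < k \<Longrightarrow> i l = i' l) \<Longrightarrow> sgd A y \<eta> x\<^sub>1 i k = sgd A y \<eta> x\<^sub>1 i' k"
  by (induction A y \<eta> x\<^sub>1 i k rule: sgd.induct) auto

text \<open>\<open>K\<close> is arbitrary so that the induction hypothesis concerns the same product
  space as the goal.\<close>

lemma sgd_measurable:
  fixes A :: "real^'m^'n"
  assumes "{1..<k} \<subseteq> K"
  shows "(\<lambda>i. sgd A y \<eta> x\<^sub>1 i k) \<in> borel_measurable (Pi\<^sub>M K (\<lambda>_. count_space UNIV))"
  using assms
proof (induction k rule: induct_nat_012)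
  case (ge2 k)
  have [measurable]: "(\<lambda>i. i (Suc k)) \<in> measurable (Pi\<^sub>M K (\<lambda>_. count_space UNIV)) (count_space (UNIV :: 'n set))"
    using ge2.prems by (intro measurable_component_singleton) auto
  have [measurable]: "(\<lambda>i. sgd A y \<eta> x\<^sub>1 i (Suc k)) \<in> borel_measurable (Pi\<^sub>M K (\<lambda>_. count_space UNIV))"
    by (rule ge2.IH(2)) (use ge2.prems in auto)
  have [measurable]: "(\<lambda>i. row i A) \<in> borel_measurable (count_space UNIV)"
    "(\<lambda>i. y $ i) \<in> borel_measurable (count_space UNIV)"
    by auto
  show ?case
    by simp
qed auto

text \<open>Only finitely many index tuples of length \<open>k - 1\<close> exist, so the iterate is
  bounded.\<close>

lemma finite_range_sgd:
  fixes A :: "real^'m^'n"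
  shows "finite (range (\<lambda>\<omega>. sgd A y \<eta> x\<^sub>1 (\<lambda>l. idx l \<omega>) k))"
proof -
  have "range (\<lambda>\<omega>. sgd A y \<eta> x\<^sub>1 (\<lambda>l. idx l \<omega>) k)
      \<subseteq> (\<lambda>i. sgd A y \<eta> x\<^sub>1 i k) ` (\<Pi>\<^sub>E l\<in>{1..<k}. (UNIV :: 'n set))"
  proof (rule image_subsetI)
    fix \<omega>
    have "sgd A y \<eta> x\<^sub>1 (\<lambda>l. idx l \<omega>) k = sgd A y \<eta> x\<^sub>1 (\<lambda>l\<in>{1..<k}. idx l \<omega>) k"
      by (rule sgd_cong) auto
    then show "sgd A y \<eta> x\<^sub>1 (\<lambda>l. idx l \<omega>) k
        \<in> (\<lambda>i. sgd A y \<eta> x\<^sub>1 i k) ` (\<Pi>\<^sub>E l\<in>{1..<k}. (UNIV :: 'n set))"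
      by (intro image_eqI) auto
  qed
  then show ?thesis
    by (rule finite_subset) (auto intro!: finite_PiE)
qed

section \<open>Expectations over the random indices\<close>

context prob_space
begin

lemma sgd_integrable:
  fixes A :: "real^'m^'n"
  assumes "\<And>l. 1 \<le> l \<Longrightarrow> idx l \<in> measurable M (count_space UNIV)"
  shows "integrable M (\<lambda>\<omega>. sgd A y \<eta> x\<^sub>1 (\<lambda>l. idx l \<omega>) k)"
proof -
  have eq: "sgd A y \<eta> x\<^sub>1 (\<lambda>l. idx l \<omega>) k = sgd A y \<eta> x\<^sub>1 (\<lambda>l\<in>{1..<k}. idx l \<omega>) k" for \<omega>
    by (rule sgd_cong) auto
  have "(\<lambda>\<omega>. \<lambda>l\<in>{1..<k}. idx l \<omega>) \<in> measurable M (Pi\<^sub>M {1..<k} (\<lambda>_. count_space UNIV))"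
    using assms by (intro measurable_restrict) auto
  from measurable_compose[OF this sgd_measurable[OF order_refl]]
  have "(\<lambda>\<omega>. sgd A y \<eta> x\<^sub>1 (\<lambda>l. idx l \<omega>) k) \<in> borel_measurable M"
    by (simp add: eq)
  moreover obtain b where "\<And>\<omega>. norm (sgd A y \<eta> x\<^sub>1 (\<lambda>l. idx l \<omega>) k) \<le> b"
    using finite_imp_bounded[OF finite_range_sgd[of A y \<eta> x\<^sub>1 idx k]] unfolding bounded_iff by blast
  ultimately show ?thesis
    by (intro integrable_const_bound[where B = b]) auto
qed

text \<open>The blocks \<open>{1..<k}\<close> and \<open>{k}\<close> of an independent family are
  disjoint, and each of the two variables is a measurable function of one block.\<close>

lemma indep_sgd:
  fixes A :: "real^'m^'n" and f :: "real^'m \<Rightarrow> real" and g :: "'n \<Rightarrow> real"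
  assumes indep: "indep_vars (\<lambda>_. count_space UNIV) idx {1..}" and k: "1 \<le> k"
    and f: "f \<in> borel_measurable borel"
  shows "indep_var borel (\<lambda>\<omega>. f (sgd A y \<eta> x\<^sub>1 (\<lambda>l. idx l \<omega>) k)) borel (\<lambda>\<omega>. g (idx k \<omega>))"
proof -
  have "indep_var (Pi\<^sub>M {1..<k} (\<lambda>_. count_space UNIV)) (\<lambda>\<omega>. restrict (\<lambda>l. idx l \<omega>) {1..<k})
      (Pi\<^sub>M {k} (\<lambda>_. count_space UNIV)) (\<lambda>\<omega>. restrict (\<lambda>l. idx l \<omega>) {k})"
    using k by (intro indep_var_restrict[OF indep]) auto
  moreover have "(\<lambda>i. f (sgd A y \<eta> x\<^sub>1 i k)) \<in> borel_measurable (Pi\<^sub>M {1..<k} (\<lambda>_. count_space UNIV))"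
    by (rule measurable_compose[OF sgd_measurable[OF order_refl] f])
  moreover have "(\<lambda>i. g (i k)) \<in> borel_measurable (Pi\<^sub>M {k} (\<lambda>_. count_space UNIV))"
    by (rule measurable_compose[OF measurable_component_singleton]) auto
  ultimately have "indep_var borel ((\<lambda>i. f (sgd A y \<eta> x\<^sub>1 i k)) \<circ> (\<lambda>\<omega>. \<lambda>l\<in>{1..<k}. idx l \<omega>))
      borel ((\<lambda>i. g (i k)) \<circ> (\<lambda>\<omega>. \<lambda>l\<in>{k}. idx l \<omega>))"
    by (rule indep_var_compose)
  moreover have "sgd A y \<eta> x\<^sub>1 (\<lambda>l. idx l \<omega>) k = sgd A y \<eta> x\<^sub>1 (\<lambda>l\<in>{1..<k}. idx l \<omega>) k" for \<omega>
    by (rule sgd_cong) auto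
  ultimately show ?thesis
    by (simp add: o_def)
qed

text \<open>Conditioning on the drawn index in elementary form: after splitting by the value of
  \<open>J\<close>, each term is a product of independent variables, and \<open>J\<close> takes each
  value with probability \<open>1 / CARD('n)\<close>.\<close>

lemma expectation_uniform_indep:
  fixes F :: "'n::finite \<Rightarrow> 'a \<Rightarrow> real" and J :: "'a \<Rightarrow> 'n" and a :: "'n \<Rightarrow> 'c::euclidean_space"
  assumes J: "J \<in> measurable M (count_space UNIV)"
    and unif: "distr M (count_space UNIV) J = uniform_count_measure UNIV"
    and indep: "\<And>i. indep_var borel (F i) borel (\<lambda>\<omega>. indicator {i} (J \<omega>) :: real)"
    and F: "\<And>i. integrable M (F i)"
  shows "integrable M (\<lambda>\<omega>. F (J \<omega>) \<omega> *\<^sub>R a (J \<omega>))"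
    and "(\<integral>\<omega>. F (J \<omega>) \<omega> *\<^sub>R a (J \<omega>) \<partial>M)
      = (1 / real CARD('n)) *\<^sub>R (\<Sum>i\<in>UNIV. (\<integral>\<omega>. F i \<omega> \<partial>M) *\<^sub>R a i)"
proof -
  have split: "F (J \<omega>) \<omega> *\<^sub>R a (J \<omega>) = (\<Sum>i\<in>UNIV. (F i \<omega> * indicator {i} (J \<omega>)) *\<^sub>R a i)" for \<omega>
    by (simp add: indicator_def of_bool_def if_distrib[of "\<lambda>x. _ * x"] if_distrib[of "\<lambda>x. x *\<^sub>R _"]
        cong: if_cong)
  have int_ind: "integrable M (\<lambda>\<omega>. indicator {i} (J \<omega>) :: real)" for i
    using measurable_compose[OF J, of "indicator {i} :: 'n \<Rightarrow> real" borel]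
    by (intro integrable_const_bound[where B = 1]) (auto simp: indicator_def)
  have exp_ind: "(\<integral>\<omega>. indicator {i} (J \<omega>) \<partial>M) = 1 / real CARD('n)" for i
  proof -
    have "(\<integral>\<omega>. indicator {i} (J \<omega>) \<partial>M)
        = (\<integral>j. indicator {i} j \<partial>(distr M (count_space UNIV) J) :: real)"
      by (rule integral_distr[OF J, symmetric]) auto
    also have "\<dots> = 1 / real CARD('n)"
      by (simp add: unif measure_uniform_count_measure)
    finally show ?thesis .
  qed
  note int = indep_var_integrable[OF indep F int_ind]
  show "integrable M (\<lambda>\<omega>. F (J \<omega>) \<omega> *\<^sub>R a (J \<omega>))"
    unfolding split using int by auto
  show "(\<integral>\<omega>. F (J \<omega>) \<omega> *\<^sub>R a (J \<omega>) \<partial>M)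
      = (1 / real CARD('n)) *\<^sub>R (\<Sum>i\<in>UNIV. (\<integral>\<omega>. F i \<omega> \<partial>M) *\<^sub>R a i)"
    unfolding split using int
    by (simp add: indep_var_lebesgue_integral[OF indep F int_ind] exp_ind scaleR_sum_right)
qed

text \<open>The stochastic gradient is unbiased and affine in the iterate, so its mean is the full
  gradient at the mean iterate.\<close>

lemma expectation_sgd_step:
  fixes A :: "real^'m^'n" and y \<eta> x\<^sub>1
  assumes indep: "indep_vars (\<lambda>_. count_space UNIV) idx {1..}"
    and unif: "distr M (count_space UNIV) (idx k) = uniform_count_measure UNIV"
    and k: "1 \<le> k"
  defines "X \<equiv> \<lambda>k \<omega>. sgd A y \<eta> x\<^sub>1 (\<lambda>l. idx l \<omega>) k"
  shows "(\<integral>\<omega>. X (k + 1) \<omega> \<partial>M)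
    = (\<integral>\<omega>. X k \<omega> \<partial>M)
      - (\<eta> k / real CARD('n)) *\<^sub>R (transpose A *v (A *v (\<integral>\<omega>. X k \<omega> \<partial>M) - y))"
proof -
  have idx: "idx l \<in> measurable M (count_space UNIV)" if "1 \<le> l" for l
    using indep that by (auto simp: indep_vars_def)
  have int: "integrable M (X l)" for l
    unfolding X_def using idx by (rule sgd_integrable)
  let ?f = "\<lambda>i x. row i A \<bullet> x - y $ i"
  have intf: "integrable M (\<lambda>\<omega>. ?f i (X k \<omega>))" for i
    using int by auto
  have ind: "indep_var borel (\<lambda>\<omega>. ?f i (X k \<omega>)) borel (\<lambda>\<omega>. indicator {i} (idx k \<omega>) :: real)" for i
    unfolding X_def by (rule indep_sgd[OF indep k]) auto
  note E = expectation_uniform_indep[OF idx[OF k] unif ind intf, where a = "\<lambda>i. row i A"]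
  \<comment> \<open>The value at 0 is a dummy, so the recursion holds only from \<open>k = 1\<close>
    on.\<close>
  have step: "X (k + 1) \<omega> = X k \<omega> - \<eta> k *\<^sub>R (?f (idx k \<omega>) (X k \<omega>) *\<^sub>R row (idx k \<omega>) A)" for \<omega>
    using k by (cases k) (auto simp: X_def)
  have "(\<integral>\<omega>. X (k + 1) \<omega> \<partial>M) = (\<integral>\<omega>. X k \<omega> \<partial>M)
      - \<eta> k *\<^sub>R (\<integral>\<omega>. ?f (idx k \<omega>) (X k \<omega>) *\<^sub>R row (idx k \<omega>) A \<partial>M)"
    unfolding step
    by (simp only: Bochner_Integration.integral_diff[OF int integrable_scaleR_right[OF E(1)]]
        integral_scaleR_right)
  \<comment> \<open>The residual is affine; its constant part \<open>y $ i\<close> is preserved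
    because the total mass is 1.\<close>
  also have "(\<integral>\<omega>. ?f (idx k \<omega>) (X k \<omega>) *\<^sub>R row (idx k \<omega>) A \<partial>M)
      = (1 / real CARD('n)) *\<^sub>R (\<Sum>i\<in>UNIV. ?f i (\<integral>\<omega>. X k \<omega> \<partial>M) *\<^sub>R row i A)"
    using int by (subst E(2)) (auto simp: prob_space)
  also have "(\<Sum>i\<in>UNIV. ?f i (\<integral>\<omega>. X k \<omega> \<partial>M) *\<^sub>R row i A)
      = transpose A *v (A *v (\<integral>\<omega>. X k \<omega> \<partial>M) - y)"
    by (simp add: matrix_mult_sum[of "transpose A"] column_transpose matrix_vector_mul_component
        row_def scalar_mult_eq_scaleR)
  finally show ?thesis
    by simp
qed

end

section \<open>Bounds for the mean error in the low and high frequency subspaces\<close>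

theorem theorem2p3:
  fixes A :: "real^'m^'n"
    and U :: "real^'n^'n" and V :: "real^'m^'m" and \<sigma> :: "nat \<Rightarrow> real"
    and \<rho> :: "'n \<Rightarrow> nat" and \<kappa> :: "'m \<Rightarrow> nat"
    and x\<^sub>1 xdag :: "real^'m" and ydag \<xi> ydelta :: "real^'n"
    and \<delta> \<delta>bar c\<^sub>0 :: real and \<eta> :: "nat \<Rightarrow> real"
    and M :: "'w measure" and idx :: "nat \<Rightarrow> 'w \<Rightarrow> 'n"
    and e :: "nat \<Rightarrow> 'w \<Rightarrow> real^'m" and PL PH :: "real^'m \<Rightarrow> real^'m"
    and r L k :: nat
  assumes r: "r = rank A" "1 \<le> r"
    and ydag: "ydag \<in> range (\<lambda>x. A *v x)"
    and xdag: "is_arg_min (\<lambda>x. norm (x - x\<^sub>1)) (\<lambda>x. A *v x = ydag) xdag"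
    and ydelta: "ydelta = ydag + \<xi>"
    and \<delta>: "\<delta> = norm \<xi>"
    and \<delta>bar: "\<delta>bar = real CARD('n) powr (- 1 / 2) * \<delta>"
    and enum: "enumeration \<rho>" "enumeration \<kappa>"
    and svd: "is_svd \<rho> \<kappa> ((real CARD('n) powr (- 1 / 2)) *\<^sub>R A) U \<sigma> V"
    and L: "1 \<le> L" "L \<le> r"
    and PL: "PL = orth_proj (col_span \<kappa> V {1..L})"
    and PH: "PH = orth_proj (col_span \<kappa> V {L+1..min CARD('n) CARD('m)})"
    and M: "prob_space M"
    and indep: "prob_space.indep_vars M (\<lambda>_. count_space UNIV) idx {1..}"
    and unif: "\<And>j. 1 \<le> j \<Longrightarrow> distr M (count_space UNIV) (idx j) = uniform_count_measure UNIV"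
    and step: "\<And>j. 1 \<le> j \<Longrightarrow> 0 < \<eta> j \<and> \<eta> j \<le> c\<^sub>0"
    and c\<^sub>0: "c\<^sub>0 * Max (range (\<lambda>i. (norm (row i A))\<^sup>2)) \<le> 1"
    and e: "\<And>j \<omega>. e j \<omega> = sgd A ydelta \<eta> x\<^sub>1 (\<lambda>l. idx l \<omega>) j - xdag"
    and k: "1 \<le> k"
  shows "norm (\<integral>\<omega>. PL (e (k + 1) \<omega>) \<partial>M)
           \<le> (1 - \<eta> k * (\<sigma> L)\<^sup>2) * norm (\<integral>\<omega>. PL (e k \<omega>) \<partial>M)
              + c\<^sub>0 powr (- 1 / 2) * \<eta> k * \<delta>bar
       \<and> norm (\<integral>\<omega>. PH (e (k + 1) \<omega>) \<partial>M)
           \<le> norm (\<integral>\<omega>. PH (e k \<omega>) \<partial>M) + \<eta> k * \<sigma> (L + 1) * \<delta>bar"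
proof -
  interpret prob_space M by (fact M)
  define s where "s = real CARD('n) powr (- 1 / 2)"
  define B where "B = s *\<^sub>R A"
  define X where "X = (\<lambda>k \<omega>. sgd A ydelta \<eta> x\<^sub>1 (\<lambda>l. idx l \<omega>) k)"
  define w where "w = (\<lambda>k. (\<integral>\<omega>. e k \<omega> \<partial>M))"
  \<comment> \<open>The factor \<open>1 / CARD('n)\<close> from uniform sampling is shared equally
    by \<open>B\<close> and its transpose.\<close>
  have s: "0 < s" "s * s = 1 / real CARD('n)"
    by (auto simp: s_def powr_minus_divide simp flip: powr_add)
  have svd': "is_svd \<rho> \<kappa> B U \<sigma> V"
    using svd by (simp add: B_def s_def)
  then have V: "orthogonal_matrix V"
    by (simp add: is_svd_def)
  have sol: "A *v xdag = ydag"
    using xdag by (simp add: is_arg_min_def)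
  have \<delta>s: "\<delta>bar = norm (s *\<^sub>R \<xi>)"
    using s(1) by (simp add: \<delta>bar \<delta> s_def)
  have idx: "idx l \<in> measurable M (count_space UNIV)" if "1 \<le> l" for l
    using indep that by (auto simp: indep_vars_def)
  have intX: "integrable M (X l)" for l
    unfolding X_def using idx by (rule sgd_integrable)
  have e_eq: "e l = (\<lambda>\<omega>. X l \<omega> - xdag)" for l
    by (auto simp: e X_def)
  have int: "integrable M (e l)" for l
    unfolding e_eq using intX by auto
  have wX: "(\<integral>\<omega>. X l \<omega> \<partial>M) = w l + xdag" for l
    unfolding w_def e_eq using intX by (simp add: prob_space)
  \<comment> \<open>Both claims thereby become statements about the projected mean error
    \<open>w\<close>.\<close>
  have P_int: "(\<integral>\<omega>. orth_proj (col_span \<kappa> V I) (e l \<omega>) \<partial>M) = orth_proj (col_span \<kappa> V I) (w l)" for I l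
    unfolding w_def by (rule integral_bounded_linear[OF bounded_linear_orth_proj_col_span[OF V] int])
  have "w (k + 1) + xdag
      = w k + xdag - (\<eta> k / real CARD('n)) *\<^sub>R (transpose A *v (A *v (w k + xdag) - ydelta))"
    using expectation_sgd_step[OF indep unif[OF k] k, of A ydelta \<eta> x\<^sub>1] wX by (simp add: X_def)
  \<comment> \<open>Since \<open>xdag\<close> solves the exact system, the noise
    \<open>\<xi>\<close> takes the place of the data in the error recursion.\<close>
  also have "A *v (w k + xdag) - ydelta = A *v w k - \<xi>"
    by (simp add: matrix_vector_right_distrib sol ydelta)
  also have "(\<eta> k / real CARD('n)) *\<^sub>R (transpose A *v (A *v w k - \<xi>))
      = \<eta> k *\<^sub>R (transpose B *v (B *v w k - s *\<^sub>R \<xi>))"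
  proof -
    have "transpose B *v (B *v w k - s *\<^sub>R \<xi>) = (s * s) *\<^sub>R (transpose A *v (A *v w k - \<xi>))"
      by (simp add: B_def transpose_scalar scaleR_matrix_vector_assoc[symmetric]
          matrix_vector_mult_scaleR scaleR_diff_right[symmetric])
    then show ?thesis
      by (simp add: s(2))
  qed
  finally have w_step: "w (k + 1) = w k - \<eta> k *\<^sub>R (transpose B *v (B *v w k - s *\<^sub>R \<xi>))"
    by (simp add: algebra_simps)
  have \<eta>: "0 < \<eta> k" "\<eta> k \<le> c\<^sub>0"
    using step[OF k] by auto
  \<comment> \<open>The squared singular value is the mean square of the row products with a unit
    vector, so the largest squared row norm dominates it.\<close>
  have c\<sigma>: "c\<^sub>0 * (\<sigma> (\<kappa> j))\<^sup>2 \<le> 1" for j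
  proof -
    let ?m = "Max (range (\<lambda>i. (norm (row i A))\<^sup>2))"
    have nv: "norm (column j V) = 1"
      using V by (simp add: orthogonal_matrix_orthonormal_columns)
    have "(\<sigma> (\<kappa> j))\<^sup>2 = (norm (B *v column j V))\<^sup>2"
      by (simp add: singular_value_eq_norm[OF enum svd'])
    also have "\<dots> = s * s * (norm (A *v column j V))\<^sup>2"
      by (simp add: B_def scaleR_matrix_vector_assoc[symmetric] power_mult_distrib power2_eq_square)
    also have "\<dots> \<le> s * s * (real CARD('n) * ?m)"
      using norm_matrix_vector_le_Max_row[of A "column j V"] s(1) nv by (intro mult_left_mono) auto
    also have "\<dots> = ?m"
      by (simp add: s(2))
    finally have "c\<^sub>0 * (\<sigma> (\<kappa> j))\<^sup>2 \<le> c\<^sub>0 * ?m"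
      using \<eta> by (intro mult_left_mono) auto
    with c\<^sub>0 show ?thesis by simp
  qed
  have \<eta>\<sigma>: "0 \<le> 1 - \<eta> k * (\<sigma> (\<kappa> j))\<^sup>2" for j
    using mult_right_mono[OF \<eta>(2), of "(\<sigma> (\<kappa> j))\<^sup>2"] c\<sigma>[of j] by simp
  have \<sigma>c: "\<sigma> (\<kappa> j) \<le> c\<^sub>0 powr (- 1 / 2)" for j
  proof -
    have "(\<sigma> (\<kappa> j))\<^sup>2 \<le> 1 / c\<^sub>0"
      using c\<sigma>[of j] \<eta> by (simp add: field_simps)
    then have "\<sigma> (\<kappa> j) \<le> sqrt (1 / c\<^sub>0)"
      by (rule real_le_rsqrt)
    also have "\<dots> = c\<^sub>0 powr (- 1 / 2)"
      using \<eta> by (simp add: powr_minus_divide powr_half_sqrt real_sqrt_divide)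
    finally show ?thesis .
  qed
  \<comment> \<open>The bound \<open>\<eta>\<sigma>\<close> speaks of indices
    \<open>\<kappa> j\<close>. Index 1 is always of this form, and
    \<open>\<sigma> L \<le> \<sigma> 1\<close> transfers the bound to \<open>L\<close>.\<close>
  obtain j\<^sub>1 where j\<^sub>1: "\<kappa> j\<^sub>1 = 1"
  proof -
    have "1 \<in> range \<kappa>"
      using enum(2) by (simp add: enumeration_def bij_betw_def Suc_leI)
    then show thesis
      using that by force
  qed
  have "\<sigma> L \<le> \<sigma> 1" "0 \<le> \<sigma> L"
    using is_svd_antimono[OF svd' _ L(1)] is_svd_nonneg[OF svd' L(1)] by auto
  then have "(\<sigma> L)\<^sup>2 \<le> (\<sigma> 1)\<^sup>2"
    by (intro power_mono)
  with \<eta>(1) have "\<eta> k * (\<sigma> L)\<^sup>2 \<le> \<eta> k * (\<sigma> 1)\<^sup>2"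
    by (intro mult_left_mono) auto
  with \<eta>\<sigma>[of j\<^sub>1] j\<^sub>1 have CL: "0 \<le> 1 - \<eta> k * (\<sigma> L)\<^sup>2"
    by simp
  \<comment> \<open>Here \<open>C = 1 - \<eta> k * (\<sigma> L)\<^sup>2\<close>, as
    \<open>\<sigma> L\<close> is the smallest singular value in the block, and
    \<open>D = c\<^sub>0 powr (- 1 / 2)\<close> bounds all of them.\<close>
  have "norm (PL (w (k + 1))) \<le> (1 - \<eta> k * (\<sigma> L)\<^sup>2) * norm (PL (w k)) + c\<^sub>0 powr (- 1 / 2) * \<eta> k * norm (s *\<^sub>R \<xi>)"
    unfolding PL w_step
  proof (rule norm_orth_proj_landweber_le[OF enum svd' _ CL])
    fix j assume "\<kappa> j \<in> {1..L}"
    then have "\<sigma> L \<le> \<sigma> (\<kappa> j)"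
      using is_svd_antimono[OF svd'] by auto
    then have "(\<sigma> L)\<^sup>2 \<le> (\<sigma> (\<kappa> j))\<^sup>2"
      using \<open>0 \<le> \<sigma> L\<close> by (intro power_mono)
    then have "\<eta> k * (\<sigma> L)\<^sup>2 \<le> \<eta> k * (\<sigma> (\<kappa> j))\<^sup>2"
      using \<eta>(1) by (intro mult_left_mono) auto
    then show "\<bar>1 - \<eta> k * (\<sigma> (\<kappa> j))\<^sup>2\<bar> \<le> 1 - \<eta> k * (\<sigma> L)\<^sup>2"
      using \<eta>\<sigma>[of j] by simp
  qed (use \<eta> \<sigma>c in auto)
  \<comment> \<open>Here \<open>C = 1\<close>, since small singular values give no uniform
    contraction, and \<open>D = \<sigma> (L + 1)\<close> is 0 when \<open>L = r\<close>.\<close>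
  moreover have "norm (PH (w (k + 1))) \<le> 1 * norm (PH (w k)) + \<sigma> (L + 1) * \<eta> k * norm (s *\<^sub>R \<xi>)"
    unfolding PH w_step
  proof (rule norm_orth_proj_landweber_le[OF enum svd'])
    show "\<sigma> (\<kappa> j) \<le> \<sigma> (L + 1)" if "\<kappa> j \<in> {L + 1..min CARD('n) CARD('m)}" for j
      using that is_svd_antimono[OF svd'] by auto
    show "0 \<le> \<sigma> (L + 1)"
      using is_svd_nonneg[OF svd'] by auto
    show "\<bar>1 - \<eta> k * (\<sigma> (\<kappa> j))\<^sup>2\<bar> \<le> 1" for j
      using \<eta>\<sigma>[of j] \<eta>(1) by simp
  qed (use \<eta> in auto)
  ultimately show ?thesis
    unfolding PL PH P_int \<delta>s by (simp add: mult_ac)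
qed

end
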